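(* Let $X$ be a complex Banach space, let $\alpha\ge0$, let $T\in\mathcal B(X)$ be a $(C,\alpha)$-bounded operator, and let $0<s<1$. Then $$\overline{(I-T)^sX}=\overline{(I-T)X}.$$
   Context: For $\alpha\in\mathbb R$: $k^\alpha(0)=1$, $k^\alpha(n)=\frac{\alpha(\alpha+1)\cdots(\alpha+n-1)}{n!}$ for $n\ge1$ (coefficients of $(1-z)^{-\alpha}$). For $T\in\mathcal B(X)$: $\Delta^{-\alpha}\mathcal T(n)=\sum_{j=0}^nk^\alpha(n-j)T^j$, and $T$ is $(C,\alpha)$-bounded if $\sup_n\|\Delta^{-\alpha}\mathcal T(n)\|/k^{\alpha+1}(n)<\infty$. For $0<s<1$, $(I-T)^s\in\mathcal B(X)$ is defined by the functional calculus applied to $(1-z)^s=\sum_nk^{-s}(n)z^n$: $(I-T)^s:=\sum_{n=0}^\infty D^\alpha k^{-s}(n)\,\Delta^{-\alpha}\mathcal T(n)$ (absolutely convergent in operator norm), where $D^\alpha f(n)=\sum_{j=n}^\infty k^{-\alpha}(j-n)f(j)$. Bars denote norm closures. *)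

theory Defs
  imports "HOL-Analysis.Analysis"
begin

text \<open>Complex Banach spaces: the distribution only has the real class \<^class>\<open>banach\<close>; the
  complex scalar multiplication extends the real one, and the norm is absolutely homogeneous
  over the complex numbers.\<close>

class complex_banach = banach +
  fixes scaleC :: "complex \<Rightarrow> 'a \<Rightarrow> 'a"  (infixr \<open>*\<^sub>C\<close> 75)
  assumes scaleC_add_right: "a *\<^sub>C (x + y) = a *\<^sub>C x + a *\<^sub>C y"
    and scaleC_add_left: "(a + b) *\<^sub>C x = a *\<^sub>C x + b *\<^sub>C x"
    and scaleC_scaleC: "a *\<^sub>C (b *\<^sub>C x) = (a * b) *\<^sub>C x"
    and scaleC_one: "1 *\<^sub>C x = x"
    and scaleC_of_real: "complex_of_real r *\<^sub>C x = r *\<^sub>R x"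
    and norm_scaleC: "norm (a *\<^sub>C x) = cmod a * norm x"

instantiation complex :: complex_banach
begin

definition scaleC_complex :: "complex \<Rightarrow> complex \<Rightarrow> complex" where
  "scaleC_complex a x = a * x"

instance
  by standard (simp_all add: scaleC_complex_def algebra_simps norm_mult scaleR_conv_of_real)

end

text \<open>The bounded operators on a complex Banach space are the elements of the library type
  of bounded real-linear maps that satisfy this predicate; the operator norm is the same.\<close>

definition complex_linear :: "('a::complex_banach \<Rightarrow>\<^sub>L 'a) \<Rightarrow> bool" where
  "complex_linear T \<longleftrightarrow> (\<forall>c x. blinfun_apply T (c *\<^sub>C x) = c *\<^sub>C blinfun_apply T x)"

definition blinfun_pow :: "('a::real_normed_vector \<Rightarrow>\<^sub>L 'a) \<Rightarrow> nat \<Rightarrow> ('a \<Rightarrow>\<^sub>L 'a)" where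
  "blinfun_pow T n = ((\<lambda>S. T o\<^sub>L S) ^^ n) id_blinfun"

definition cesaro_k :: "real \<Rightarrow> nat \<Rightarrow> real" where
  "cesaro_k \<alpha> n = pochhammer \<alpha> n / fact n"

definition cesaro_sum :: "real \<Rightarrow> ('a::real_normed_vector \<Rightarrow>\<^sub>L 'a) \<Rightarrow> nat \<Rightarrow> ('a \<Rightarrow>\<^sub>L 'a)" where
  "cesaro_sum \<alpha> T n = (\<Sum>j=0..n. cesaro_k \<alpha> (n - j) *\<^sub>R blinfun_pow T j)"

definition cesaro_bounded :: "real \<Rightarrow> ('a::real_normed_vector \<Rightarrow>\<^sub>L 'a) \<Rightarrow> bool" where
  "cesaro_bounded \<alpha> T \<longleftrightarrow>
     bdd_above (range (\<lambda>n. norm (cesaro_sum \<alpha> T n) / cesaro_k (\<alpha> + 1) n))"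

text \<open>The sum over \<open>j \<ge> n\<close>, indexed by \<open>i = j - n\<close>.\<close>

definition weyl_diff :: "real \<Rightarrow> (nat \<Rightarrow> real) \<Rightarrow> nat \<Rightarrow> real" where
  "weyl_diff \<alpha> f n = (\<Sum>i. cesaro_k (-\<alpha>) i * f (n + i))"

text \<open>\<open>(I - T)\<^sup>s\<close> for a \<open>(C,\<alpha>)\<close>-bounded operator \<open>T\<close> and \<open>0 < s < 1\<close>; the series is taken
  in the operator norm.\<close>

definition frac_power_I_minus ::
    "real \<Rightarrow> real \<Rightarrow> ('a::real_normed_vector \<Rightarrow>\<^sub>L 'a) \<Rightarrow> ('a \<Rightarrow>\<^sub>L 'a)" where
  "frac_power_I_minus \<alpha> s T =
     (\<Sum>n. weyl_diff \<alpha> (cesaro_k (-s)) n *\<^sub>R cesaro_sum \<alpha> T n)"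

end

theory Submission imports Defs begin

text \<open>Write \<open>w = D\<^sup>\<alpha> k\<^sup>-\<^sup>s\<close> and \<open>S\<^sub>n = \<Delta>\<^sup>-\<^sup>\<alpha>T(n)\<close>. A telescoping argument gives
  \<open>w(n) k\<^sup>\<alpha>\<^sup>+\<^sup>1(n) = w(0) k\<^sup>-\<^sup>s(n)\<close>, and \<open>\<Sum> k\<^sup>-\<^sup>s(n) = 0\<close>. Since
  \<open>S\<^sub>n x - k\<^sup>\<alpha>\<^sup>+\<^sup>1(n) x\<close> lies in the range of \<open>I - T\<close>, so do, up to closure, the values of
  \<open>(I - T)\<^sup>s = \<Sum> w(n) S\<^sub>n\<close>.

  Conversely \<open>(I - T)\<^sup>s (I - T)\<^sup>1\<^sup>-\<^sup>s = I - T\<close>. For \<open>(I - r T)\<^sup>s\<close> with \<open>r < 1\<close> the analogue is a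
  Cauchy product, so it suffices that \<open>(I - r T)\<^sup>s \<rightarrow> (I - T)\<^sup>s\<close> in norm as \<open>r \<rightarrow> 1\<close>. Here
  \<open>(I - r T)\<^sup>s = \<Sum> v\<^sub>r(n) S\<^sub>n\<close> with \<open>v\<^sub>r = D\<^sup>\<alpha>(r\<^sup>n k\<^sup>-\<^sup>s(n))\<close>; as \<open>-k\<^sup>-\<^sup>s(n + 1)\<close> is a moment sequence,
  \<open>v\<^sub>r(n) \<le> 0\<close> for \<open>n \<ge> 1\<close>, and Scheffe's lemma applies to \<open>v\<^sub>r k\<^sup>\<alpha>\<^sup>+\<^sup>1\<close>, whose sum is \<open>(1 - r)\<^sup>s \<rightarrow> 0\<close>.\<close>

section \<open>The numbers \<open>cesaro_k\<close>: recurrences, generating function, decay\<close>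

lemma cesaro_k_0 [simp]: "cesaro_k a 0 = 1"
  by (simp add: cesaro_k_def)

lemma cesaro_k_Suc: "real (Suc n) * cesaro_k a (Suc n) = (a + real n) * cesaro_k a n"
  by (simp add: cesaro_k_def pochhammer_Suc field_simps del: of_nat_Suc)

lemma cesaro_k_Suc': "real (Suc n) * cesaro_k a (Suc n) = a * cesaro_k (a + 1) n"
  by (simp add: cesaro_k_def pochhammer_rec field_simps del: of_nat_Suc)

lemma cesaro_k_zero: "cesaro_k 0 n = (if n = 0 then 1 else 0)"
  by (simp add: cesaro_k_def pochhammer_0_left)

lemma cesaro_k_one: "cesaro_k 1 n = 1"
  by (simp add: cesaro_k_def flip: pochhammer_fact)

lemma cesaro_k_minus_one: "cesaro_k (-1) n = (if n = 0 then 1 else if n = 1 then -1 else 0)"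
proof (cases n)
  case (Suc m)
  then have "real (Suc m) * cesaro_k (-1) n = - cesaro_k 0 m"
    using cesaro_k_Suc'[of m "-1"] by simp
  then show ?thesis
    using Suc by (auto simp: cesaro_k_zero split: if_splits)
qed simp

lemma cesaro_k_pos: "a > 0 \<Longrightarrow> cesaro_k a n > 0"
  by (simp add: cesaro_k_def pochhammer_pos)

text \<open>Coefficient form of (1 - z)^(-a) (1 - z)^(-b) = (1 - z)^(-a-b), obtained from the
  Vandermonde identity for rising factorials.\<close>

lemma cesaro_k_convolution:
  "(\<Sum>j\<le>n. cesaro_k a j * cesaro_k b (n - j)) = cesaro_k (a + b) n"
  unfolding cesaro_k_def pochhammer_binomial_sum sum_divide_distrib
  by (rule sum.cong) (auto simp: binomial_fact)

lemma sum_cesaro_k: "(\<Sum>j\<le>n. cesaro_k a j) = cesaro_k (a + 1) n"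
  using cesaro_k_convolution[of a 1 n] by (simp add: cesaro_k_one)

text \<open>This is Newton's binomial series at -z with exponent -a; the two signs (-1)^n
  cancel.\<close>

lemma cesaro_k_sums:
  assumes "\<bar>z\<bar> < 1"
  shows "(\<lambda>n. cesaro_k a n * z ^ n) sums (1 - z) powr (- a)"
proof -
  have "cesaro_k a n * z ^ n = (- a gchoose n) * (- z) ^ n" for n
  proof -
    have "(- a gchoose n) * (- z) ^ n = ((-1) ^ n * (-1) ^ n) * (cesaro_k a n * z ^ n)"
      unfolding gbinomial_pochhammer cesaro_k_def by (subst power_minus) simp
    also have "(-1) ^ n * (-1 :: real) ^ n = 1"
      by (simp flip: power_mult_distrib)
    finally show ?thesis by simp
  qed
  then show ?thesis
    using gen_binomial_real[of "-z" "-a"] assms by simp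
qed

lemma summable_abs_cesaro_k_power:
  assumes "0 \<le> r" "r < 1"
  shows "summable (\<lambda>n. \<bar>cesaro_k a n\<bar> * r ^ n)"
proof -
  obtain q where "r < q" "q < 1"
    using dense assms by blast
  then have "summable (\<lambda>n. cesaro_k a n * q ^ n)" "norm r < norm q"
    using cesaro_k_sums[of q a] assms by (auto simp: sums_iff)
  then show ?thesis
    using powser_insidea[of "cesaro_k a" q r] assms by (simp add: abs_mult)
qed

lemma cesaro_k_bounded:
  assumes "a \<le> 1"
  obtains B where "B > 0" "\<And>n. \<bar>cesaro_k a n\<bar> \<le> B"
proof -
  \<comment> \<open>From index \<open>N\<close> on, \<open>a + n\<close> lies between 0 and
    \<open>n + 1\<close>, so the recurrence makes the moduli nonincreasing.\<close>
  define N where "N = nat \<lceil>-a\<rceil>"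
  have N: "- a \<le> real N"
    unfolding N_def by linarith
  have *: "\<bar>cesaro_k a (N + n)\<bar> \<le> \<bar>cesaro_k a N\<bar>" for n
  proof (induction n)
    case (Suc n)
    have "real (Suc (N + n)) * \<bar>cesaro_k a (Suc (N + n))\<bar>
        = \<bar>a + real (N + n)\<bar> * \<bar>cesaro_k a (N + n)\<bar>"
      using arg_cong[OF cesaro_k_Suc[of "N + n" a], of abs] by (simp only: abs_mult abs_of_nat)
    also have "\<dots> \<le> real (Suc (N + n)) * \<bar>cesaro_k a (N + n)\<bar>"
      using N assms by (intro mult_right_mono) auto
    finally have "\<bar>cesaro_k a (Suc (N + n))\<bar> \<le> \<bar>cesaro_k a (N + n)\<bar>"
      by (simp del: of_nat_Suc)
    with Suc show ?case by simp
  qed simp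
  have "Bseq (cesaro_k a)"
  proof (rule Bseq_offset)
    show "Bseq (\<lambda>n. cesaro_k a (n + N))"
      using * by (intro BseqI'[of _ "\<bar>cesaro_k a N\<bar>"]) (simp add: add.commute)
  qed
  then show ?thesis
    using that by (auto simp: Bseq_def)
qed

text \<open>The recurrence \<open>n * cesaro_k (-s) n = - s * cesaro_k (1 - s) (n - 1)\<close>
  reduces the sign to the positivity for parameter 1 - s > 0.\<close>

lemma cesaro_k_neg:
  assumes "0 < s" "s < 1" "n > 0"
  shows "cesaro_k (-s) n < 0"
proof -
  obtain m where n: "n = Suc m"
    using assms by (cases n) auto
  have "cesaro_k (1 - s) m > 0"
    using assms by (intro cesaro_k_pos) simp
  moreover have "real n * cesaro_k (-s) n = - (s * cesaro_k (1 - s) m)"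
    using cesaro_k_Suc'[of m "-s"] by (simp add: n)
  ultimately have "real n * cesaro_k (-s) n < 0"
    using assms by simp
  then show ?thesis
    using assms by (simp add: mult_less_0_iff)
qed

text \<open>Euler's limit for 1/Gamma gives the asymptotics n^(-s) / Gamma(1 - s). The factor n / (1
  - s + n) removes the one surplus factor of the rising factorial in
  \<open>rGamma_series\<close>.\<close>

lemma cesaro_k_tendsto_0:
  assumes "0 < s" "s < 1"
  shows "cesaro_k (1 - s) \<longlonglongrightarrow> 0"
proof -
  have "(\<lambda>n. inverse (1 + (1 - s) / real n)) \<longlonglongrightarrow> inverse (1 + 0)"
    by (intro tendsto_intros lim_const_over_n) simp
  then have "(\<lambda>n. inverse (1 + (1 - s) / real n)) \<longlonglongrightarrow> 1"
    by simp
  then have ratio: "(\<lambda>n. real n / (1 - s + real n)) \<longlonglongrightarrow> 1"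
  proof (rule Lim_transform_eventually)
    show "\<forall>\<^sub>F n in sequentially. inverse (1 + (1 - s) / real n) = real n / (1 - s + real n)"
      using eventually_gt_at_top[of 0] by eventually_elim (use assms in \<open>simp add: field_simps\<close>)
  qed
  have "(\<lambda>n. rGamma_series (1 - s) n * real n powr (-s) * (real n / (1 - s + real n))) \<longlonglongrightarrow>
      rGamma (1 - s) * 0 * 1"
    using assms
    by (intro tendsto_mult rGamma_series_LIMSEQ tendsto_neg_powr filterlim_real_sequentially ratio)
       auto
  then have lim: "(\<lambda>n. rGamma_series (1 - s) n * real n powr (-s) * (real n / (1 - s + real n))) \<longlonglongrightarrow> 0"
    by simp
  show ?thesis
  proof (rule Lim_transform_eventually[OF lim])
    show "\<forall>\<^sub>F n in sequentially. rGamma_series (1 - s) n * real n powr (-s) *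
        (real n / (1 - s + real n)) = cesaro_k (1 - s) n"
      using eventually_gt_at_top[of "0::nat"]
    proof eventually_elim
      case (elim n)
      have "exp ((1 - s) * ln (real n)) = real n powr (1 - s)"
        using elim by (simp add: powr_def)
      also have "\<dots> = real n powr (-s) * real n"
        using elim by (simp add: powr_diff powr_minus field_simps)
      finally have rG: "rGamma_series (1 - s) n
          = pochhammer (1 - s) n * (1 - s + real n) / (fact n * (real n powr (-s) * real n))"
        by (simp add: rGamma_series_def pochhammer_Suc)
      have "real n powr (-s) \<noteq> 0" "1 - s + real n \<noteq> 0" "real n \<noteq> 0"
        using elim assms by auto
      then show ?case
        unfolding rG cesaro_k_def by (simp add: divide_simps)
    qed
  qed
qed

text \<open>The partial sums are \<open>cesaro_k (1 - s)\<close>, which tends to 0; this is the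
  value of (1 - z)^s at z = 1.\<close>

lemma cesaro_k_sums_0:
  assumes "0 < s" "s < 1"
  shows "cesaro_k (-s) sums 0"
  using cesaro_k_tendsto_0[OF assms] by (simp add: sums_def_le sum_cesaro_k)

text \<open>All terms after the first are negative, so plain convergence is already
  absolute.\<close>

lemma summable_abs_cesaro_k:
  assumes "0 < s" "s < 1"
  shows "summable (\<lambda>n. \<bar>cesaro_k (-s) n\<bar>)"
proof -
  have "summable (\<lambda>n. - cesaro_k (-s) (Suc n))"
    using cesaro_k_sums_0[OF assms] by (intro summable_minus) (simp add: summable_Suc_iff sums_iff)
  then have "summable (\<lambda>n. \<bar>cesaro_k (-s) (Suc n)\<bar>)"
    using cesaro_k_neg[OF assms] by (simp add: abs_of_neg)
  then show ?thesis
    using summable_Suc_iff by blast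
qed

lemma abs_cesaro_k_le_1:
  assumes "0 < s" "s < 1"
  shows "\<bar>cesaro_k (-s) n\<bar> \<le> 1"
proof (induction n)
  case (Suc n)
  have "real (Suc n) * \<bar>cesaro_k (-s) (Suc n)\<bar> = \<bar>-s + real n\<bar> * \<bar>cesaro_k (-s) n\<bar>"
    using arg_cong[OF cesaro_k_Suc[of n "-s"], of abs] by (simp only: abs_mult abs_of_nat)
  also have "\<dots> \<le> real (Suc n) * 1"
    using assms Suc by (intro mult_mono) auto
  finally show ?case
    by (simp del: of_nat_Suc)
qed simp

section \<open>The weights \<open>weyl_diff \<alpha> (cesaro_k (-s))\<close>\<close>

lemma summable_weyl_diff:
  assumes "0 \<le> \<alpha>" "0 < s" "s < 1"
  shows "summable (\<lambda>i. \<bar>cesaro_k (-\<alpha>) i\<bar> * \<bar>cesaro_k (-s) (n + i)\<bar>)"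
proof -
  obtain B where B: "\<And>i. \<bar>cesaro_k (-\<alpha>) i\<bar> \<le> B"
    using cesaro_k_bounded[of "-\<alpha>"] assms by auto
  have "summable (\<lambda>i. B * \<bar>cesaro_k (-s) (i + n)\<bar>)"
    using summable_abs_cesaro_k[OF assms(2,3)]
    by (intro summable_mult) (rule summable_ignore_initial_segment)
  then show ?thesis
    by (rule summable_comparison_test') (auto simp: add.commute intro: mult_right_mono B)
qed

text \<open>The recurrences of both factors combine termwise into a telescoping difference, so the
  two series differ by boundary terms that vanish.\<close>

lemma weyl_diff_cesaro_k_Suc:
  assumes "0 \<le> \<alpha>" "0 < s" "s < 1"
  shows "(real n + \<alpha> + 1) * weyl_diff \<alpha> (cesaro_k (-s)) (Suc n)
       = (real n - s) * weyl_diff \<alpha> (cesaro_k (-s)) n"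
proof -
  define k where "k = cesaro_k (-\<alpha>)"
  define f where "f = cesaro_k (-s)"
  \<comment> \<open>Telescoping certificate: \<open>g 0 = 0\<close>, and \<open>g i\<close> tends to
    0 because \<open>k\<close> is bounded and \<open>m * f m\<close> tends to 0.\<close>
  define g where "g i = real i * k i * f (n + i)" for i
  have summ: "summable (\<lambda>i. k i * f (m + i))" for m
    using summable_weyl_diff[OF assms, of m]
    by (intro summable_norm_cancel[of "\<lambda>i. k i * f (m + i)"]) (simp add: abs_mult k_def f_def)
  have step: "(real n + \<alpha> + 1) * (k i * f (Suc n + i)) - (real n - s) * (k i * f (n + i))
      = g i - g (Suc i)" for i
  proof -
    have 1: "(real n + real i + 1) * f (Suc n + i) = (real n + real i - s) * f (n + i)"
      using cesaro_k_Suc[of "n + i" "-s"] by (simp add: f_def algebra_simps)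
    have 2: "(real i + 1) * k (Suc i) = (real i - \<alpha>) * k i"
      using cesaro_k_Suc[of i "-\<alpha>"] by (simp add: k_def algebra_simps)
    have "g (Suc i) = ((real i + 1) * k (Suc i)) * f (Suc n + i)"
      by (simp add: g_def add.commute)
    also have "\<dots> = (real i - \<alpha>) * k i * f (Suc n + i)"
      by (simp only: 2)
    finally have "g i - g (Suc i) = (real n + \<alpha> + 1) * (k i * f (Suc n + i)) 
       - (k i * ((real n + real i + 1) * f (Suc n + i)) - real i * k i * f (n + i))"
      by (simp add: g_def algebra_simps)
    also have "\<dots> = (real n + \<alpha> + 1) * (k i * f (Suc n + i)) - (real n - s) * (k i * f (n + i))"
      by (simp only: 1) (simp add: algebra_simps)
    finally show ?thesis ..
  qed
  obtain B where B: "\<And>i. \<bar>k i\<bar> \<le> B"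
    using cesaro_k_bounded[of "-\<alpha>"] assms by (auto simp: k_def)
  \<comment> \<open>Shifted by one index, the term is
    \<open>- s * cesaro_k (1 - s) (i + n)\<close>.\<close>
  have "(\<lambda>i. (real i + real n) * f (i + n)) \<longlonglongrightarrow> 0"
  proof (rule LIMSEQ_imp_Suc)
    have "(\<lambda>i. - s * cesaro_k (1 - s) (i + n)) \<longlonglongrightarrow> - s * 0"
      by (intro tendsto_mult tendsto_const LIMSEQ_ignore_initial_segment cesaro_k_tendsto_0 assms)
    then show "(\<lambda>i. (real (Suc i) + real n) * f (Suc i + n)) \<longlonglongrightarrow> 0"
      using cesaro_k_Suc'[of "_ + n" "-s"] by (simp add: f_def add_ac)
  qed
  then have "(\<lambda>i. B * \<bar>(real i + real n) * f (i + n)\<bar>) \<longlonglongrightarrow> B * \<bar>0\<bar>"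
    by (intro tendsto_intros)
  then have "g \<longlonglongrightarrow> 0"
  proof (intro tendsto_0_le[where g = g and K = 1])
    show "\<forall>\<^sub>F i in sequentially. norm (g i) \<le> norm (B * \<bar>(real i + real n) * f (i + n)\<bar>) * 1"
    proof (intro always_eventually allI)
      fix i
      have "\<bar>k i\<bar> * (real i * \<bar>f (n + i)\<bar>) \<le> \<bar>B\<bar> * ((real i + real n) * \<bar>f (i + n)\<bar>)"
        by (intro mult_mono order_trans[OF B]) (auto simp: add.commute)
      then show "norm (g i) \<le> norm (B * \<bar>(real i + real n) * f (i + n)\<bar>) * 1"
        by (simp add: g_def abs_mult mult_ac)
    qed
  qed auto
  then have "(\<lambda>i. g i - g (Suc i)) sums (g 0 - 0)"
    by (rule telescope_sums')
  then have "(\<lambda>i. (real n + \<alpha> + 1) * (k i * f (Suc n + i)) - (real n - s) * (k i * f (n + i))) sums 0"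
    by (simp only: step) (simp add: g_def)
  moreover have "(\<lambda>i. (real n + \<alpha> + 1) * (k i * f (Suc n + i)) - (real n - s) * (k i * f (n + i)))
     sums ((real n + \<alpha> + 1) * weyl_diff \<alpha> f (Suc n) - (real n - s) * weyl_diff \<alpha> f n)"
    unfolding weyl_diff_def k_def[symmetric]
    by (intro sums_diff sums_mult summable_sums summ)
  ultimately show ?thesis
    unfolding f_def[symmetric] using sums_unique2 by fastforce
qed

text \<open>The factor n + \<alpha> + 1 in the recurrence of the weights cancels against that of
  \<open>cesaro_k (\<alpha> + 1)\<close>, so the product obeys the recurrence of
  \<open>cesaro_k (-s)\<close>. Summability and the sum 0 carry over.\<close>

lemma weyl_diff_times_cesaro_k:
  assumes "0 \<le> \<alpha>" "0 < s" "s < 1"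
  shows "weyl_diff \<alpha> (cesaro_k (-s)) n * cesaro_k (\<alpha> + 1) n
       = weyl_diff \<alpha> (cesaro_k (-s)) 0 * cesaro_k (-s) n"
proof (induction n)
  case (Suc n)
  let ?w = "weyl_diff \<alpha> (cesaro_k (-s))"
  have "real (Suc n) * (?w (Suc n) * cesaro_k (\<alpha> + 1) (Suc n))
      = ((real n + \<alpha> + 1) * ?w (Suc n)) * cesaro_k (\<alpha> + 1) n"
    using arg_cong[OF cesaro_k_Suc[of n "\<alpha> + 1"], of "\<lambda>x. ?w (Suc n) * x"]
    by (simp add: algebra_simps)
  also have "\<dots> = (real n - s) * (?w n * cesaro_k (\<alpha> + 1) n)"
    by (simp add: weyl_diff_cesaro_k_Suc[OF assms])
  also have "\<dots> = ?w 0 * ((- s + real n) * cesaro_k (-s) n)"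
    unfolding Suc.IH by (simp add: algebra_simps)
  also have "\<dots> = real (Suc n) * (?w 0 * cesaro_k (-s) (Suc n))"
    by (simp only: cesaro_k_Suc[symmetric]) (simp add: mult_ac)
  finally show ?case
    by (simp del: of_nat_Suc)
qed simp

section \<open>Sign of the damped weights through a moment representation\<close>

text \<open>A Beta integral with parameters n + 1 - s and 1 + s, its Gamma quotient rewritten by
  rising factorials.\<close>

lemma has_integral_cesaro_k_moment:
  fixes s :: real and n :: nat
  assumes "0 < s" "s < 1"
  shows "((\<lambda>x. x ^ n * (x powr (-s) * (1 - x) powr s)) has_integral
           Gamma (1 - s) * Gamma (1 + s) / s * (- cesaro_k (-s) (Suc n))) {0..1}"
proof -
  have "((\<lambda>x. x powr (real n + 1 - s - 1) * (1 - x) powr (1 + s - 1)) has_integral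
      Beta (real n + 1 - s) (1 + s)) {0..1}"
    using assms by (intro has_integral_Beta_real) auto
  moreover have "Beta (real n + 1 - s) (1 + s)
      = Gamma (1 - s) * Gamma (1 + s) / s * (- cesaro_k (-s) (Suc n))"
  proof -
    have "1 - s \<notin> \<int>\<^sub>\<le>\<^sub>0"
      using assms by (auto elim!: nonpos_Ints_cases)
    then have "Gamma (real n + 1 - s) = pochhammer (1 - s) n * Gamma (1 - s)"
      using assms less_imp_neq[OF Gamma_real_pos[of "1 - s"]]
      by (simp add: pochhammer_Gamma add.commute add_diff_eq)
    moreover have "Gamma (real n + 1 - s + (1 + s)) = fact (Suc n)"
      using Gamma_fact[of "Suc n", where ?'a = real] by (simp add: algebra_simps)
    ultimately show ?thesis
      using assms by (simp add: Beta_def cesaro_k_def pochhammer_rec del: fact_Suc)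
  qed
  ultimately have "((\<lambda>x. x powr (real n - s) * (1 - x) powr s) has_integral
      Gamma (1 - s) * Gamma (1 + s) / s * (- cesaro_k (-s) (Suc n))) {0..1}"
    by (simp add: algebra_simps)
  then show ?thesis
  proof (rule has_integral_eq[rotated])
    fix x :: real assume "x \<in> {0..1}"
    then show "x powr (real n - s) * (1 - x) powr s = x ^ n * (x powr (-s) * (1 - x) powr s)"
      \<comment> \<open>At x = 0 both sides are 0, since \<open>0 powr\<close> of anything is
        0.\<close>
      by (cases "x = 0") (auto simp: powr_diff powr_minus powr_realpow field_simps)
  qed
qed

text \<open>Formally the value is a negative multiple of the integral of x^(n-1) (1 - r x)^\<alpha>
  x^(-s) (1 - x)^s over [0,1]. Only finite sums are integrated, with an error that vanishes in the
  limit, so sum and integral are never exchanged.\<close>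

lemma weyl_diff_power_nonpos:
  assumes "0 \<le> \<alpha>" "0 < s" "s < 1" "0 < r" "r < 1" "n > 0"
  shows "weyl_diff \<alpha> (\<lambda>n. cesaro_k (-s) n * r ^ n) n \<le> 0"
proof -
  obtain m where n: "n = Suc m"
    using assms by (cases n) auto
  define c where "c = Gamma (1 - s) * Gamma (1 + s) / s"
  have c: "c > 0"
    using assms by (auto simp: c_def intro!: divide_pos_pos mult_pos_pos)
  define \<phi> where "\<phi> x = x powr (-s) * (1 - x) powr s" for x :: real
  define g where "g i = - cesaro_k (-s) (Suc i)" for i
  have g: "((\<lambda>x. x ^ i * \<phi> x) has_integral c * g i) {0..1}" for i
    using has_integral_cesaro_k_moment[OF assms(2,3), of i] by (simp add: c_def \<phi>_def g_def)
  define k where "k = cesaro_k (-\<alpha>)"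
  \<comment> \<open>Tail of the absolute series at x = 1; it bounds the tails at all x in [0,1] at
    once.\<close>
  define \<epsilon> where "\<epsilon> N = (\<Sum>i. \<bar>k (i + N)\<bar> * r ^ (i + N))" for N
  have sum_k: "summable (\<lambda>i. \<bar>k i\<bar> * r ^ i)"
    using summable_abs_cesaro_k_power[of r "-\<alpha>"] assms by (simp add: k_def)
  have \<epsilon>: "\<epsilon> \<longlonglongrightarrow> 0"
    unfolding \<epsilon>_def using suminf_exist_split2[OF sum_k] .
  \<comment> \<open>The full series is \<open>(1 - r x)\<^sup>\<alpha> \<ge> 0\<close>, so a partial sum is bounded below by minus the tail.\<close>
  have lower: "- \<epsilon> N \<le> (\<Sum>i<N. k i * (r * x) ^ i)" if x: "x \<in> {0..1}" for x N
  proof -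
    have "0 \<le> r * x" "r * x \<le> r"
      using assms x mult_left_le[of x r] by auto
    then have rx: "0 \<le> r * x" "r * x \<le> r" "\<bar>r * x\<bar> < 1"
      using assms by linarith+
    have sums: "(\<lambda>i. k i * (r * x) ^ i) sums (1 - r * x) powr \<alpha>"
      using cesaro_k_sums[OF rx(3), of "-\<alpha>"] by (simp add: k_def)
    then have summ: "summable (\<lambda>i. k i * (r * x) ^ i)"
      by (simp add: sums_iff)
    have "(\<Sum>i. k (i + N) * (r * x) ^ (i + N)) \<le> \<epsilon> N"
      unfolding \<epsilon>_def
    proof (rule suminf_le)
      fix i
      have "k (i + N) * (r * x) ^ (i + N) \<le> \<bar>k (i + N)\<bar> * (r * x) ^ (i + N)"
        using rx by (intro mult_right_mono) auto
      also have "\<dots> \<le> \<bar>k (i + N)\<bar> * r ^ (i + N)"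
        using rx by (intro mult_left_mono power_mono) auto
      finally show "k (i + N) * (r * x) ^ (i + N) \<le> \<bar>k (i + N)\<bar> * r ^ (i + N)" .
    qed (use summable_ignore_initial_segment[OF summ] summable_ignore_initial_segment[OF sum_k] in auto)
    moreover have "(1 - r * x) powr \<alpha>
        = (\<Sum>i. k (i + N) * (r * x) ^ (i + N)) + (\<Sum>i<N. k i * (r * x) ^ i)"
      using suminf_split_initial_segment[OF summ, of N] sums by (simp add: sums_iff)
    moreover have "(1 - r * x) powr \<alpha> \<ge> 0"
      by simp
    ultimately show ?thesis by linarith
  qed
  \<comment> \<open>The bound \<open>lower\<close> is integrated against the nonnegative function
    \<open>x ^ m * \<phi> x\<close>, and the positive constant \<open>c\<close> is
    cancelled.\<close>
  have partial: "- \<epsilon> N * g m \<le> (\<Sum>i<N. k i * r ^ i * g (m + i))" for N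
  proof -
    have "- \<epsilon> N * (c * g m) \<le> (\<Sum>i<N. k i * r ^ i * (c * g (m + i)))"
    proof (rule has_integral_le)
      show "((\<lambda>x. \<Sum>i<N. k i * r ^ i * (x ^ (m + i) * \<phi> x)) has_integral
          (\<Sum>i<N. k i * r ^ i * (c * g (m + i)))) {0..1}"
        by (intro has_integral_sum has_integral_mult_right g) auto
      show "((\<lambda>x. - \<epsilon> N * (x ^ m * \<phi> x)) has_integral - \<epsilon> N * (c * g m)) {0..1}"
        by (intro has_integral_mult_right g)
      fix x :: real assume x: "x \<in> {0..1}"
      have "- \<epsilon> N * (x ^ m * \<phi> x) \<le> (\<Sum>i<N. k i * (r * x) ^ i) * (x ^ m * \<phi> x)"
        using x by (intro mult_right_mono lower) (auto simp: \<phi>_def)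
      also have "\<dots> = (\<Sum>i<N. k i * r ^ i * (x ^ (m + i) * \<phi> x))"
        unfolding sum_distrib_right by (simp add: power_mult_distrib power_add mult_ac)
      finally show "- \<epsilon> N * (x ^ m * \<phi> x) \<le> (\<Sum>i<N. k i * r ^ i * (x ^ (m + i) * \<phi> x))" .
    qed
    then have "c * (- \<epsilon> N * g m) \<le> c * (\<Sum>i<N. k i * r ^ i * g (m + i))"
      by (simp add: sum_distrib_left mult_ac)
    then show ?thesis
      using c by (simp only: mult_le_cancel_left_pos)
  qed
  have "summable (\<lambda>i. k i * r ^ i * g (m + i))"
  proof (rule summable_comparison_test'[OF sum_k])
    fix i
    have "\<bar>k i\<bar> * r ^ i * \<bar>g (m + i)\<bar> \<le> \<bar>k i\<bar> * r ^ i * 1"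
      using abs_cesaro_k_le_1[OF assms(2,3)] assms by (intro mult_left_mono) (auto simp: g_def)
    then show "norm (k i * r ^ i * g (m + i)) \<le> \<bar>k i\<bar> * r ^ i"
      using assms by (simp add: abs_mult)
  qed
  then have "(\<lambda>i. k i * r ^ i * g (m + i)) sums (\<Sum>i. k i * r ^ i * g (m + i))"
    by (rule summable_sums)
  then have sums: "(\<lambda>i. - (r ^ n) * (k i * r ^ i * g (m + i))) sums
      (- (r ^ n) * (\<Sum>i. k i * r ^ i * g (m + i)))"
    and lim: "(\<lambda>N. \<Sum>i<N. k i * r ^ i * g (m + i)) \<longlonglongrightarrow> (\<Sum>i. k i * r ^ i * g (m + i))"
    by (rule sums_mult, simp only: sums_def)
  have "(\<lambda>N. - \<epsilon> N * g m) \<longlonglongrightarrow> - 0 * g m"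
    by (intro tendsto_intros \<epsilon>)
  from tendsto_le[OF _ lim this] have "(\<Sum>i. k i * r ^ i * g (m + i)) \<ge> 0"
    using partial by simp
  moreover have "weyl_diff \<alpha> (\<lambda>n. cesaro_k (-s) n * r ^ n) n
      = - (r ^ n) * (\<Sum>i. k i * r ^ i * g (m + i))"
    using sums_unique[OF sums] by (simp add: weyl_diff_def k_def g_def n power_add mult_ac)
  ultimately show ?thesis
    using assms by simp
qed

section \<open>Double series summed by rows and by antidiagonals\<close>

text \<open>Domination by a product of summable sequences makes the family absolutely summable over
  all pairs, so the order of summation is irrelevant. It serves Cauchy products as well as the
  rearrangement behind the damped weights.\<close>

lemma sums_diagonal:
  fixes F :: "nat \<Rightarrow> nat \<Rightarrow> 'b::banach"
  assumes "summable x" "summable y" and F: "\<And>n m. norm (F n m) \<le> x n * y m"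
    and nonneg: "\<And>n. x n \<ge> (0::real)" "\<And>n. y n \<ge> (0::real)"
  shows "(\<lambda>n. \<Sum>m. F n m) sums (\<Sum>N. \<Sum>n\<le>N. F n (N - n))"
    and "summable (\<lambda>N. \<Sum>n\<le>N. F n (N - n))"
proof -
  have xy: "x summable_on UNIV" "y summable_on UNIV"
    using assms by (auto simp: summable_on_UNIV_nonneg_real_iff)
  have "(\<lambda>(n, m). x n * y m) summable_on UNIV \<times> UNIV"
    using xy nonneg
    by (intro summable_on_SigmaI[where g = "\<lambda>n. x n * infsum y UNIV"])
       (auto intro!: has_sum_cmult_right summable_on_cmult_left)
  then have "(\<lambda>p. norm (case p of (n, m) \<Rightarrow> F n m)) summable_on UNIV \<times> UNIV"
    by (rule Infinite_Sum.abs_summable_on_comparison_test') (use F in auto)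
  then have "(\<lambda>(n, m). F n m) summable_on UNIV \<times> UNIV"
    by (rule Infinite_Sum.abs_summable_summable)
  then obtain S where S: "((\<lambda>(n, m). F n m) has_sum S) (UNIV \<times> UNIV)"
    by (auto simp: summable_on_def)
  have inner: "((\<lambda>m. F n m) has_sum (\<Sum>m. F n m)) UNIV" for n
  proof -
    have "summable (\<lambda>m. norm (F n m))"
      by (rule summable_comparison_test'[OF summable_mult[OF assms(2), of "x n"]]) (use F in auto)
    then show ?thesis
      using norm_summable_imp_has_sum summable_sums[OF summable_norm_cancel] by blast
  qed
  have "((\<lambda>n. \<Sum>m. F n m) has_sum S) UNIV"
    by (rule has_sum_SigmaD[OF S]) (use inner in auto)
  then have 1: "(\<lambda>n. \<Sum>m. F n m) sums S"
    by (rule has_sum_imp_sums)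
  \<comment> \<open>Pairs (n, m) are regrouped by \<open>N = n + m\<close>, with n running up to
    \<open>N\<close>.\<close>
  have "((\<lambda>(N, n). F n (N - n)) has_sum S) (SIGMA N:UNIV. {..N})"
    using S by (subst has_sum_reindex_bij_witness[where j = "\<lambda>(N, n). (n, N - n)" and i = "\<lambda>(n, m). (n + m, n)"]) auto
  then have "((\<lambda>N. \<Sum>n\<le>N. F n (N - n)) has_sum S) UNIV"
    by (rule has_sum_SigmaD) (auto intro: has_sum_finite)
  then have 2: "(\<lambda>N. \<Sum>n\<le>N. F n (N - n)) sums S"
    by (rule has_sum_imp_sums)
  then show "(\<lambda>n. \<Sum>m. F n m) sums (\<Sum>N. \<Sum>n\<le>N. F n (N - n))"
    using 1 by (simp add: sums_iff)
  show "summable (\<lambda>N. \<Sum>n\<le>N. F n (N - n))"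
    using 2 by (simp add: sums_iff)
qed

section \<open>Damped weights and their limit as r tends to 1\<close>

lemma weyl_diff_power_bound:
  assumes "0 < s" "s < 1" "0 < r" "r < 1"
  shows "\<bar>cesaro_k (-\<alpha>) i * (cesaro_k (-s) (n + i) * r ^ (n + i))\<bar>
       \<le> r ^ n * (\<bar>cesaro_k (-\<alpha>) i\<bar> * r ^ i)"
proof -
  have "\<bar>cesaro_k (-\<alpha>) i\<bar> * (\<bar>cesaro_k (-s) (n + i)\<bar> * r ^ (n + i))
      \<le> \<bar>cesaro_k (-\<alpha>) i\<bar> * (1 * r ^ (n + i))"
    using assms by (intro mult_left_mono mult_right_mono abs_cesaro_k_le_1) auto
  then show ?thesis
    using assms by (simp add: abs_mult power_add mult_ac)
qed

text \<open>Inserting the formula for \<open>t\<close> gives antidiagonal sums; summing by rows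
  instead collects the weight of each \<open>S j\<close>. The damping r < 1 beats the growth of
  \<open>S\<close>. The values are general because both operator Cesaro sums and the scalars
  \<open>cesaro_k (\<alpha> + 1)\<close> are inserted.\<close>

lemma weyl_diff_power_sums:
  fixes S t :: "nat \<Rightarrow> 'b::banach"
  assumes "0 < s" "s < 1" "0 < r" "r < 1"
    and t: "\<And>n. t n = (\<Sum>j\<le>n. cesaro_k (-\<alpha>) (n - j) *\<^sub>R S j)"
    and S: "\<And>n. norm (S n) \<le> M * cesaro_k (\<alpha> + 1) n"
  shows "(\<lambda>j. weyl_diff \<alpha> (\<lambda>n. cesaro_k (-s) n * r ^ n) j *\<^sub>R S j) sums
         (\<Sum>n. (cesaro_k (-s) n * r ^ n) *\<^sub>R t n)"
proof -
  define k where "k = cesaro_k (-\<alpha>)"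
  define f where "f = cesaro_k (-s)"
  define F where "F j i = (k i * (f (j + i) * r ^ (j + i))) *\<^sub>R S j" for j i
  have y: "summable (\<lambda>i. \<bar>k i\<bar> * r ^ i)"
    using summable_abs_cesaro_k_power[of r "-\<alpha>"] assms by (simp add: k_def)
  have x: "summable (\<lambda>j. r ^ j * norm (S j))"
  proof (rule summable_comparison_test')
    show "summable (\<lambda>j. \<bar>M\<bar> * (\<bar>cesaro_k (\<alpha> + 1) j\<bar> * r ^ j))"
      using assms by (intro summable_mult summable_abs_cesaro_k_power) auto
    fix j
    have "norm (S j) \<le> \<bar>M\<bar> * \<bar>cesaro_k (\<alpha> + 1) j\<bar>"
      using S[of j] abs_ge_self[of "M * cesaro_k (\<alpha> + 1) j"] by (simp add: abs_mult)
    then have "r ^ j * norm (S j) \<le> r ^ j * (\<bar>M\<bar> * \<bar>cesaro_k (\<alpha> + 1) j\<bar>)"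
      using assms by (intro mult_left_mono) auto
    then show "norm (r ^ j * norm (S j)) \<le> \<bar>M\<bar> * (\<bar>cesaro_k (\<alpha> + 1) j\<bar> * r ^ j)"
      using assms by (simp add: abs_mult mult_ac)
  qed
  have bound: "\<bar>k i * (f (j + i) * r ^ (j + i))\<bar> \<le> r ^ j * (\<bar>k i\<bar> * r ^ i)" for i j
    unfolding k_def f_def using assms(1-4) by (rule weyl_diff_power_bound)
  have F: "norm (F j i) \<le> (r ^ j * norm (S j)) * (\<bar>k i\<bar> * r ^ i)" for j i
    using mult_right_mono[OF bound[of i j], of "norm (S j)"] by (simp add: F_def mult_ac)
  have "(\<lambda>j. \<Sum>i. F j i) sums (\<Sum>n. \<Sum>j\<le>n. F j (n - j))"
    using assms by (intro sums_diagonal[OF x y F]) auto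
  moreover have "(\<Sum>i. F j i) = weyl_diff \<alpha> (\<lambda>n. f n * r ^ n) j *\<^sub>R S j" for j
  proof -
    have "summable (\<lambda>i. k i * (f (j + i) * r ^ (j + i)))"
      by (rule summable_comparison_test'[OF summable_mult[OF y, of "r ^ j"]]) (use bound in auto)
    then show ?thesis
      by (simp add: F_def weyl_diff_def k_def suminf_scaleR_left)
  qed
  moreover have "(\<Sum>j\<le>n. F j (n - j)) = (f n * r ^ n) *\<^sub>R t n" for n
    by (simp add: F_def t k_def scaleR_sum_right mult_ac)
  ultimately show ?thesis
    by (simp add: f_def)
qed

text \<open>Scheffe's argument: off \<open>j = 0\<close> all the terms have the same sign, so pointwise convergence
  together with convergence of the total mass \<open>(1 - r)\<^sup>s \<rightarrow> 0\<close> gives convergence in the weighted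
  \<open>\<ell>\<^sup>1\<close> norm.\<close>

lemma weyl_diff_power_tendsto:
  fixes R :: "nat \<Rightarrow> real"
  assumes "0 \<le> \<alpha>" "0 < s" "s < 1"
    and R: "\<And>N. 0 < R N" "\<And>N. R N < 1" "R \<longlonglongrightarrow> 1"
  defines "D N j \<equiv> \<bar>weyl_diff \<alpha> (\<lambda>n. cesaro_k (-s) n * R N ^ n) j - weyl_diff \<alpha> (cesaro_k (-s)) j\<bar>
      * cesaro_k (\<alpha> + 1) j"
  shows "summable (D N)" and "(\<lambda>N. \<Sum>j. D N j) \<longlonglongrightarrow> 0"
proof -
  define K where "K = cesaro_k (\<alpha> + 1)"
  define w where "w = weyl_diff \<alpha> (cesaro_k (-s))"
  define v where "v N = weyl_diff \<alpha> (\<lambda>n. cesaro_k (-s) n * R N ^ n)" for N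
  have K: "K j > 0" for j
    using assms by (simp add: K_def cesaro_k_pos)
  have p: "w j * K j = w 0 * cesaro_k (-s) j" for j
    unfolding w_def K_def by (rule weyl_diff_times_cesaro_k[OF assms(1-3)])
  have p_sums: "(\<lambda>j. w j * K j) sums 0"
    unfolding p using sums_mult[OF cesaro_k_sums_0[OF assms(2,3)], of "w 0"] by simp
  have p_abs: "summable (\<lambda>j. \<bar>w j * K j\<bar>)"
    unfolding p abs_mult by (intro summable_mult summable_abs_cesaro_k assms)
  \<comment> \<open>Taking \<open>S = K\<close> makes \<open>t\<close> constantly 1, so the total
    mass is the binomial series of (1 - r)^s.\<close>
  have q_sums: "(\<lambda>j. v N j * K j) sums (1 - R N) powr s" for N
  proof -
    have "(\<lambda>j. v N j *\<^sub>R K j) sums (\<Sum>n. (cesaro_k (-s) n * R N ^ n) *\<^sub>R (1::real))"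
      unfolding v_def
    proof (rule weyl_diff_power_sums)
      show "(1::real) = (\<Sum>j\<le>n. cesaro_k (-\<alpha>) (n - j) *\<^sub>R K j)" for n
        using cesaro_k_convolution[of "\<alpha> + 1" "-\<alpha>" n] by (simp add: K_def cesaro_k_one mult.commute)
      show "norm (K j) \<le> 1 * cesaro_k (\<alpha> + 1) j" for j
        using K[of j] by (simp add: K_def)
    qed (use assms in auto)
    moreover have "(\<lambda>n. cesaro_k (-s) n * R N ^ n) sums (1 - R N) powr s"
      using cesaro_k_sums[of "R N" "-s"] R(1,2)[of N] by simp
    ultimately show ?thesis
      by (simp add: sums_iff)
  qed
  have v_neg: "v N j \<le> 0" if "j > 0" for N j
    unfolding v_def using assms that by (intro weyl_diff_power_nonpos) auto
  \<comment> \<open>Dominated convergence for series: dropping the powers of \<open>R N\<close>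
    leaves a majorant free of \<open>N\<close>.\<close>
  have v_lim: "(\<lambda>N. v N j) \<longlonglongrightarrow> w j" for j
  proof -
    have "(\<lambda>N. \<Sum>i. cesaro_k (-\<alpha>) i * (cesaro_k (-s) (j + i) * R N ^ (j + i)))
        \<longlonglongrightarrow> (\<Sum>i. cesaro_k (-\<alpha>) i * (cesaro_k (-s) (j + i) * 1 ^ (j + i)))"
    proof (rule tannerys_theorem[THEN conjunct2, THEN conjunct2])
      show "(\<lambda>N. cesaro_k (-\<alpha>) i * (cesaro_k (-s) (j + i) * R N ^ (j + i)))
          \<longlonglongrightarrow> cesaro_k (-\<alpha>) i * (cesaro_k (-s) (j + i) * 1 ^ (j + i))" for i
        by (intro tendsto_intros R)
      show "summable (\<lambda>i. \<bar>cesaro_k (-\<alpha>) i\<bar> * \<bar>cesaro_k (-s) (j + i)\<bar>)"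
        by (rule summable_weyl_diff[OF assms(1-3)])
      have "norm (cesaro_k (-\<alpha>) i * (cesaro_k (-s) (j + i) * R N ^ (j + i)))
          \<le> \<bar>cesaro_k (-\<alpha>) i\<bar> * \<bar>cesaro_k (-s) (j + i)\<bar>" for i N
        using R(1,2)[of N] mult_left_mono[of "R N ^ (j + i)" 1 "\<bar>cesaro_k (-\<alpha>) i\<bar> * \<bar>cesaro_k (-s) (j + i)\<bar>"]
        by (simp add: abs_mult power_le_one mult_ac)
      then show "\<forall>\<^sub>F (i, N) in sequentially \<times>\<^sub>F sequentially.
          norm (cesaro_k (-\<alpha>) i * (cesaro_k (-s) (j + i) * R N ^ (j + i)))
          \<le> \<bar>cesaro_k (-\<alpha>) i\<bar> * \<bar>cesaro_k (-s) (j + i)\<bar>"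
        by (intro always_eventually) auto
    qed simp
    then show ?thesis
      by (simp add: v_def w_def weyl_diff_def)
  qed
  define d where "d N j = v N j * K j - w j * K j" for N j
  have d_sums: "d N sums (1 - R N) powr s" for N
    unfolding d_def using sums_diff[OF q_sums p_sums, of N] by simp
  \<comment> \<open>For j > 0 the term \<open>v N j * K j\<close> is nonpositive, so the positive
    part of \<open>d N j\<close> has a majorant independent of \<open>N\<close>.\<close>
  have d_le: "max (d N j) 0 \<le> \<bar>w j * K j\<bar>" if "j > 0" for N j
  proof -
    have "v N j * K j \<le> 0"
      using v_neg[OF that] K[of j] by (simp add: mult_nonpos_nonneg less_imp_le)
    then show ?thesis
      unfolding d_def by linarith
  qed
  have max_summable: "summable (\<lambda>j. max (d N j) 0)" for N
    by (rule summable_comparison_test'[OF p_abs, of 1]) (use d_le in auto)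
  \<comment> \<open>By |d| = 2 max(d, 0) - d, only the dominated positive part needs a limit
    theorem; the sum of d itself is known exactly.\<close>
  have D_eq: "D N j = 2 * max (d N j) 0 - d N j" for N j
  proof -
    have "D N j = \<bar>(v N j - w j) * K j\<bar>"
      using K[of j] by (simp add: D_def v_def w_def K_def abs_mult)
    also have "\<dots> = \<bar>d N j\<bar>"
      by (simp add: d_def left_diff_distrib)
    finally show ?thesis by auto
  qed
  have D_sums: "D N sums (2 * (\<Sum>j. max (d N j) 0) - (1 - R N) powr s)" for N
    unfolding D_eq[abs_def] by (intro sums_diff sums_mult summable_sums max_summable d_sums)
  then show "summable (D N)"
    by (rule sums_summable)
  have "(\<lambda>N. \<Sum>j. max (d N j) 0) \<longlonglongrightarrow> (\<Sum>j::nat. max 0 (0::real))"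
  proof (rule tannerys_theorem[THEN conjunct2, THEN conjunct2])
    show "(\<lambda>N. max (d N j) 0) \<longlonglongrightarrow> max 0 0" for j
    proof (intro tendsto_max tendsto_const)
      have "(\<lambda>N. d N j) \<longlonglongrightarrow> w j * K j - w j * K j"
        unfolding d_def by (intro tendsto_intros v_lim)
      then show "(\<lambda>N. d N j) \<longlonglongrightarrow> 0" by simp
    qed
    \<comment> \<open>The majorant is available for j > 0 only; an eventual bound suffices.\<close>
    have "\<forall>\<^sub>F (j, N::nat) in sequentially \<times>\<^sub>F sequentially. 0 < (j::nat)"
      by (subst eventually_prod1) auto
    then show "\<forall>\<^sub>F (j, N) in sequentially \<times>\<^sub>F sequentially. norm (max (d N j) 0) \<le> \<bar>w j * K j\<bar>"
      by (rule eventually_mono) (use d_le in auto)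
  qed (use p_abs in auto)
  moreover have "(\<lambda>N. (1 - R N) powr s) \<longlonglongrightarrow> 0"
  proof -
    have "(\<lambda>N. 1 - R N) \<longlonglongrightarrow> 1 - 1"
      by (intro tendsto_intros R)
    then have "(\<lambda>N. (1 - R N) powr s) \<longlonglongrightarrow> 0 powr s"
      using R(2) assms by (intro tendsto_powr2) (auto intro!: always_eventually less_imp_le)
    then show ?thesis by simp
  qed
  ultimately have "(\<lambda>N. 2 * (\<Sum>j. max (d N j) 0) - (1 - R N) powr s) \<longlonglongrightarrow> 2 * 0 - 0"
    by (intro tendsto_intros) simp_all
  then show "(\<lambda>N. \<Sum>j. D N j) \<longlonglongrightarrow> 0"
    using D_sums by (simp add: sums_iff)
qed

section \<open>Operator powers recovered from Cesaro sums\<close>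

lemma blinfun_pow_0 [simp]: "blinfun_pow T 0 = id_blinfun"
  by (simp add: blinfun_pow_def)

lemma blinfun_pow_Suc: "blinfun_pow T (Suc n) = T o\<^sub>L blinfun_pow T n"
  by (simp add: blinfun_pow_def)

lemma blinfun_pow_1 [simp]: "blinfun_pow T (Suc 0) = T"
  by (intro blinfun_eqI) (simp add: blinfun_pow_Suc)

lemma blinfun_pow_add: "blinfun_pow T (m + n) = blinfun_pow T m o\<^sub>L blinfun_pow T n"
  by (intro blinfun_eqI, induction m) (simp_all add: blinfun_pow_Suc)

text \<open>Convolution with \<open>cesaro_k (-\<alpha>)\<close> inverts convolution with
  \<open>cesaro_k \<alpha>\<close>, because their convolution is \<open>cesaro_k 0\<close>, the unit
  at 0.\<close>

lemma blinfun_pow_eq_cesaro_sum: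
  "blinfun_pow T n = (\<Sum>j\<le>n. cesaro_k (-\<alpha>) (n - j) *\<^sub>R cesaro_sum \<alpha> T j)"
proof -
  have "(\<Sum>j\<le>n. cesaro_k (-\<alpha>) (n - j) *\<^sub>R cesaro_sum \<alpha> T j)
      = (\<Sum>j\<le>n. \<Sum>i\<le>j. (cesaro_k (-\<alpha>) (n - j) * cesaro_k \<alpha> (j - i)) *\<^sub>R blinfun_pow T i)"
    by (simp add: cesaro_sum_def scaleR_sum_right atLeast0AtMost)
  also have "\<dots> = (\<Sum>i\<le>n. \<Sum>j\<in>{i..n}. (cesaro_k (-\<alpha>) (n - j) * cesaro_k \<alpha> (j - i)) *\<^sub>R blinfun_pow T i)"
    unfolding sum.Sigma[OF finite_atMost ballI[OF finite_atMost]] sum.Sigma[OF finite_atMost ballI[OF finite_atLeastAtMost]]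
    by (rule sum.reindex_bij_witness[of _ "\<lambda>(i, j). (j, i)" "\<lambda>(i, j). (j, i)"]) auto
  also have "\<dots> = (\<Sum>i\<le>n. cesaro_k 0 (n - i) *\<^sub>R blinfun_pow T i)"
  proof (rule sum.cong)
    fix i assume "i \<in> {..n}"
    then have "(\<Sum>j\<in>{i..n}. cesaro_k (-\<alpha>) (n - j) * cesaro_k \<alpha> (j - i))
        = (\<Sum>m\<le>n - i. cesaro_k \<alpha> m * cesaro_k (-\<alpha>) (n - i - m))"
      by (intro sum.reindex_bij_witness[of _ "\<lambda>m. i + m" "\<lambda>j. j - i"]) (auto simp: mult.commute)
    also have "\<dots> = cesaro_k 0 (n - i)"
      using cesaro_k_convolution[of \<alpha> "-\<alpha>" "n - i"] by simp
    finally show "(\<Sum>j\<in>{i..n}. (cesaro_k (-\<alpha>) (n - j) * cesaro_k \<alpha> (j - i)) *\<^sub>R blinfun_pow T i)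
        = cesaro_k 0 (n - i) *\<^sub>R blinfun_pow T i"
      by (simp flip: scaleR_sum_left)
  qed simp
  also have "\<dots> = (\<Sum>i\<le>n. if i = n then blinfun_pow T i else 0)"
    by (rule sum.cong) (auto simp: cesaro_k_zero)
  finally show ?thesis by simp
qed

lemma cesaro_boundedE:
  assumes "cesaro_bounded \<alpha> T" "\<alpha> \<ge> 0"
  obtains M where "M \<ge> 0" "\<And>n. norm (cesaro_sum \<alpha> T n) \<le> M * cesaro_k (\<alpha> + 1) n"
proof -
  obtain M where M: "\<And>n. norm (cesaro_sum \<alpha> T n) / cesaro_k (\<alpha> + 1) n \<le> M"
    using assms unfolding cesaro_bounded_def bdd_above_def by auto
  have K: "cesaro_k (\<alpha> + 1) n > 0" for n
    using assms by (simp add: cesaro_k_pos)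
  have "0 \<le> M"
    using M[of 0] order_trans[OF norm_ge_zero[of "cesaro_sum \<alpha> T 0"], of M] by simp
  moreover have "norm (cesaro_sum \<alpha> T n) \<le> M * cesaro_k (\<alpha> + 1) n" for n
    using M[of n] K[of n] by (simp add: divide_le_eq)
  ultimately show ?thesis using that by blast
qed

section \<open>Power series in r T for r < 1\<close>

text \<open>The inversion formula bounds the terms by the Cauchy product of two series that converge
  for r < 1.\<close>

lemma summable_power_blinfun_pow:
  fixes T :: "'a::banach \<Rightarrow>\<^sub>L 'a"
  assumes "cesaro_bounded \<alpha> T" "\<alpha> \<ge> 0" "0 < r" "r < 1"
  shows "summable (\<lambda>n. r ^ n * norm (blinfun_pow T n))"
proof -
  obtain M where M: "M \<ge> 0" "\<And>n. norm (cesaro_sum \<alpha> T n) \<le> M * cesaro_k (\<alpha> + 1) n"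
    using assms cesaro_boundedE by blast
  define x where "x j = M * (\<bar>cesaro_k (\<alpha> + 1) j\<bar> * r ^ j)" for j
  define y where "y i = \<bar>cesaro_k (-\<alpha>) i\<bar> * r ^ i" for i
  have xy: "summable x" "summable y"
    unfolding x_def y_def using assms by (auto intro!: summable_mult summable_abs_cesaro_k_power)
  have nonneg: "x j \<ge> 0" "y j \<ge> 0" for j
    using M(1) assms by (auto simp: x_def y_def)
  have "summable (\<lambda>n. \<Sum>j\<le>n. x j * y (n - j))"
    using xy nonneg by (intro sums_diagonal(2)[of x y]) auto
  then show ?thesis
  proof (rule summable_comparison_test')
    fix n
    have "norm (blinfun_pow T n) \<le> (\<Sum>j\<le>n. \<bar>cesaro_k (-\<alpha>) (n - j)\<bar> * norm (cesaro_sum \<alpha> T j))"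
      unfolding blinfun_pow_eq_cesaro_sum[of T n \<alpha>] by (rule order_trans[OF norm_sum]) simp
    also have "\<dots> \<le> (\<Sum>j\<le>n. \<bar>cesaro_k (-\<alpha>) (n - j)\<bar> * (M * \<bar>cesaro_k (\<alpha> + 1) j\<bar>))"
      using M by (intro sum_mono mult_left_mono order_trans[OF M(2)]) auto
    finally have "r ^ n * norm (blinfun_pow T n)
        \<le> r ^ n * (\<Sum>j\<le>n. \<bar>cesaro_k (-\<alpha>) (n - j)\<bar> * (M * \<bar>cesaro_k (\<alpha> + 1) j\<bar>))"
      using assms by (intro mult_left_mono) auto
    also have "\<dots> = (\<Sum>j\<le>n. x j * y (n - j))"
      unfolding sum_distrib_left x_def y_def
      by (intro sum.cong) (auto simp: mult_ac simp flip: power_add)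
    finally show "norm (r ^ n * norm (blinfun_pow T n)) \<le> (\<Sum>j\<le>n. x j * y (n - j))"
      using assms by simp
  qed
qed

text \<open>\<open>(I - r T)\<^sup>s\<close>\<close>

definition abel_frac_power :: "real \<Rightarrow> real \<Rightarrow> ('a::real_normed_vector \<Rightarrow>\<^sub>L 'a) \<Rightarrow> ('a \<Rightarrow>\<^sub>L 'a)" where
  "abel_frac_power r s T = (\<Sum>n. (cesaro_k (-s) n * r ^ n) *\<^sub>R blinfun_pow T n)"

lemma summable_abel_frac_power:
  fixes T :: "'a::banach \<Rightarrow>\<^sub>L 'a"
  assumes "cesaro_bounded \<alpha> T" "\<alpha> \<ge> 0" "0 < r" "r < 1" "0 < s" "s < 1"
  shows "summable (\<lambda>n. norm ((cesaro_k (-s) n * r ^ n) *\<^sub>R blinfun_pow T n))"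
proof (rule summable_comparison_test'[OF summable_power_blinfun_pow[OF assms(1-4)]])
  fix n
  have "\<bar>cesaro_k (-s) n\<bar> * (r ^ n * norm (blinfun_pow T n)) \<le> 1 * (r ^ n * norm (blinfun_pow T n))"
    using assms by (intro mult_right_mono abs_cesaro_k_le_1) auto
  then show "norm (norm ((cesaro_k (-s) n * r ^ n) *\<^sub>R blinfun_pow T n)) \<le> r ^ n * norm (blinfun_pow T n)"
    using assms by (simp add: abs_mult mult_ac)
qed

text \<open>In the Cauchy product the coefficients convolve to \<open>cesaro_k (-1)\<close>, those
  of 1 - z.\<close>

lemma abel_frac_power_compose:
  fixes T :: "'a::banach \<Rightarrow>\<^sub>L 'a"
  assumes "cesaro_bounded \<alpha> T" "\<alpha> \<ge> 0" "0 < r" "r < 1" "0 < s" "s < 1"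
  shows "abel_frac_power r s T o\<^sub>L abel_frac_power r (1 - s) T = id_blinfun - r *\<^sub>R T"
proof -
  define a where "a n = (cesaro_k (-s) n * r ^ n) *\<^sub>R blinfun_pow T n" for n
  define b where "b n = (cesaro_k (-(1 - s)) n * r ^ n) *\<^sub>R blinfun_pow T n" for n
  have a: "summable (\<lambda>n. norm (a n))"
    unfolding a_def using assms by (rule summable_abel_frac_power)
  have b: "summable (\<lambda>n. norm (b n))"
    unfolding b_def using assms(1-4) by (rule summable_abel_frac_power) (use assms in auto)
  note bil = bounded_bilinear.bounded_linear_left[OF bounded_bilinear_blinfun_compose]
    bounded_bilinear.bounded_linear_right[OF bounded_bilinear_blinfun_compose]
  have "(\<lambda>n. \<Sum>m. a n o\<^sub>L b m) sums (\<Sum>N. \<Sum>n\<le>N. a n o\<^sub>L b (N - n))"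
    by (rule sums_diagonal[OF a b]) (auto intro: norm_blinfun_compose)
  moreover have "(\<lambda>n. \<Sum>m. a n o\<^sub>L b m) = (\<lambda>n. a n o\<^sub>L suminf b)"
    by (intro ext) (rule bounded_linear.suminf[OF bil(2) summable_norm_cancel[OF b], symmetric])
  moreover have "(\<lambda>n. a n o\<^sub>L suminf b) sums (suminf a o\<^sub>L suminf b)"
    using bounded_linear.sums[OF bil(1) summable_sums[OF summable_norm_cancel[OF a]]] .
  ultimately have "suminf a o\<^sub>L suminf b = (\<Sum>N. \<Sum>n\<le>N. a n o\<^sub>L b (N - n))"
    by (auto dest: sums_unique2)
  also have "\<dots> = (\<Sum>N. (cesaro_k (-1) N * r ^ N) *\<^sub>R blinfun_pow T N)"
  proof (rule suminf_cong)
    fix N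
    have "(\<Sum>n\<le>N. a n o\<^sub>L b (N - n))
        = (\<Sum>n\<le>N. (cesaro_k (-s) n * cesaro_k (-(1 - s)) (N - n)) *\<^sub>R r ^ N *\<^sub>R blinfun_pow T N)"
    proof (rule sum.cong)
      fix n assume "n \<in> {..N}"
      then have "N = n + (N - n)" by simp
      then have "blinfun_pow T N = blinfun_pow T n o\<^sub>L blinfun_pow T (N - n)" "r ^ N = r ^ n * r ^ (N - n)"
        by (metis blinfun_pow_add, metis power_add)
      then show "a n o\<^sub>L b (N - n)
          = (cesaro_k (-s) n * cesaro_k (-(1 - s)) (N - n)) *\<^sub>R r ^ N *\<^sub>R blinfun_pow T N"
        by (simp add: a_def b_def mult_ac
            bounded_bilinear.scaleR_left[OF bounded_bilinear_blinfun_compose]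
            bounded_bilinear.scaleR_right[OF bounded_bilinear_blinfun_compose])
    qed simp
    also have "\<dots> = cesaro_k (-1) N *\<^sub>R r ^ N *\<^sub>R blinfun_pow T N"
      unfolding scaleR_sum_left[symmetric] cesaro_k_convolution by simp
    finally show "(\<Sum>n\<le>N. a n o\<^sub>L b (N - n)) = (cesaro_k (-1) N * r ^ N) *\<^sub>R blinfun_pow T N"
      by simp
  qed
  also have "\<dots> = (\<Sum>N\<in>{0, 1}. (cesaro_k (-1) N * r ^ N) *\<^sub>R blinfun_pow T N)"
    by (rule suminf_finite) (auto simp: cesaro_k_minus_one)
  also have "\<dots> = id_blinfun - r *\<^sub>R T"
    by (simp add: cesaro_k_minus_one)
  finally show ?thesis
    by (simp add: abel_frac_power_def a_def[abs_def] b_def[abs_def])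
qed

section \<open>Norm convergence, Abel limit and factorization\<close>

text \<open>Turns the \<open>suminf\<close> of the definition into actual convergence: Cesaro
  boundedness and \<open>weyl_diff_times_cesaro_k\<close> bound the norms by a multiple of
  \<open>\<bar>cesaro_k (-s) n\<bar>\<close>.\<close>

lemma frac_power_sums:
  fixes T :: "'a::banach \<Rightarrow>\<^sub>L 'a"
  assumes "cesaro_bounded \<alpha> T" "\<alpha> \<ge> 0" "0 < s" "s < 1"
  shows "(\<lambda>n. weyl_diff \<alpha> (cesaro_k (-s)) n *\<^sub>R cesaro_sum \<alpha> T n) sums frac_power_I_minus \<alpha> s T"
proof -
  let ?w = "weyl_diff \<alpha> (cesaro_k (-s))"
  obtain M where M: "M \<ge> 0" "\<And>n. norm (cesaro_sum \<alpha> T n) \<le> M * cesaro_k (\<alpha> + 1) n"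
    using assms cesaro_boundedE by blast
  have "summable (\<lambda>n. ?w n *\<^sub>R cesaro_sum \<alpha> T n)"
  proof (rule summable_comparison_test')
    show "summable (\<lambda>n. M * (\<bar>?w 0\<bar> * \<bar>cesaro_k (-s) n\<bar>))"
      using assms by (intro summable_mult summable_abs_cesaro_k)
    fix n
    have K: "cesaro_k (\<alpha> + 1) n > 0"
      using assms by (simp add: cesaro_k_pos)
    have "norm (?w n *\<^sub>R cesaro_sum \<alpha> T n) \<le> \<bar>?w n\<bar> * (M * cesaro_k (\<alpha> + 1) n)"
      using mult_left_mono[OF M(2)[of n], of "\<bar>?w n\<bar>"] by simp
    also have "\<dots> = M * \<bar>?w n * cesaro_k (\<alpha> + 1) n\<bar>"
      using K by (simp add: abs_mult)
    also have "\<dots> = M * (\<bar>?w 0\<bar> * \<bar>cesaro_k (-s) n\<bar>)"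
      unfolding weyl_diff_times_cesaro_k[OF assms(2-4)] by (simp add: abs_mult)
    finally show "norm (?w n *\<^sub>R cesaro_sum \<alpha> T n) \<le> M * (\<bar>?w 0\<bar> * \<bar>cesaro_k (-s) n\<bar>)" .
  qed
  then show ?thesis
    unfolding frac_power_I_minus_def by (rule summable_sums)
qed

text \<open>Both operators are series in the same Cesaro sums, so their distance is at most
  \<open>M\<close> times the weighted l1 distance of the weights.\<close>

lemma abel_frac_power_tendsto:
  fixes T :: "'a::banach \<Rightarrow>\<^sub>L 'a" and R :: "nat \<Rightarrow> real"
  assumes "cesaro_bounded \<alpha> T" "\<alpha> \<ge> 0" "0 < s" "s < 1"
    and R: "\<And>N. 0 < R N" "\<And>N. R N < 1" "R \<longlonglongrightarrow> 1"
  shows "(\<lambda>N. abel_frac_power (R N) s T) \<longlonglongrightarrow> frac_power_I_minus \<alpha> s T"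
proof -
  obtain M where M: "M \<ge> 0" "\<And>n. norm (cesaro_sum \<alpha> T n) \<le> M * cesaro_k (\<alpha> + 1) n"
    using assms cesaro_boundedE by blast
  define w where "w = weyl_diff \<alpha> (cesaro_k (-s))"
  define v where "v N = weyl_diff \<alpha> (\<lambda>n. cesaro_k (-s) n * R N ^ n)" for N
  define D where "D N j = \<bar>v N j - w j\<bar> * cesaro_k (\<alpha> + 1) j" for N j
  have D: "summable (D N)" "(\<lambda>N. \<Sum>j. D N j) \<longlonglongrightarrow> 0" for N
    unfolding D_def[abs_def] v_def w_def
    by (rule weyl_diff_power_tendsto[OF assms(2-4) R])+
  have "(\<lambda>j. v N j *\<^sub>R cesaro_sum \<alpha> T j) sums abel_frac_power (R N) s T" for N
    unfolding v_def abel_frac_power_def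
    using assms(3,4) R(1,2) blinfun_pow_eq_cesaro_sum M(2) by (rule weyl_diff_power_sums)
  from sums_diff[OF this frac_power_sums[OF assms(1-4)]]
  have diff: "(\<lambda>j. (v N j - w j) *\<^sub>R cesaro_sum \<alpha> T j) sums
      (abel_frac_power (R N) s T - frac_power_I_minus \<alpha> s T)" for N
    by (simp add: w_def scaleR_diff_left)
  have "norm (abel_frac_power (R N) s T - frac_power_I_minus \<alpha> s T) \<le> M * (\<Sum>j. D N j)" for N
  proof -
    have le: "norm ((v N j - w j) *\<^sub>R cesaro_sum \<alpha> T j) \<le> M * D N j" for j
      using mult_left_mono[OF M(2)[of j], of "\<bar>v N j - w j\<bar>"] by (simp add: D_def mult_ac)
    then have "norm (\<Sum>j. (v N j - w j) *\<^sub>R cesaro_sum \<alpha> T j) \<le> (\<Sum>j. M * D N j)"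
      by (intro norm_suminf_le summable_mult D)
    then show ?thesis
      using sums_unique[OF diff[of N]] suminf_mult[OF D(1)[of N], of M] by simp
  qed
  moreover have "(\<lambda>N. M * (\<Sum>j. D N j)) \<longlonglongrightarrow> 0"
    by (rule tendsto_mult_right_zero[OF D(2)])
  ultimately have "(\<lambda>N. abel_frac_power (R N) s T - frac_power_I_minus \<alpha> s T) \<longlonglongrightarrow> 0"
    by (rule Lim_null_comparison[OF always_eventually[OF allI]])
  then show ?thesis
    by (simp add: LIM_zero_iff)
qed

text \<open>Norm limit of the factorization of I - r T, as composition is jointly
  continuous.\<close>

lemma frac_power_compose:
  fixes T :: "'a::banach \<Rightarrow>\<^sub>L 'a"
  assumes "cesaro_bounded \<alpha> T" "\<alpha> \<ge> 0" "0 < s" "s < 1"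
  shows "frac_power_I_minus \<alpha> s T o\<^sub>L frac_power_I_minus \<alpha> (1 - s) T = id_blinfun - T"
proof -
  \<comment> \<open>A sequence in (0,1) with limit 1; the shift by 2 keeps \<open>R 0\<close>
    positive.\<close>
  define R where "R N = 1 - inverse (real N + 2)" for N :: nat
  have R: "0 < R N" "R N < 1" for N
    by (auto simp: R_def field_simps)
  have "(\<lambda>N. inverse (real (N + 2))) \<longlonglongrightarrow> 0"
    by (rule LIMSEQ_ignore_initial_segment[OF lim_inverse_n])
  then have "R \<longlonglongrightarrow> 1 - 0"
    unfolding R_def[abs_def] by (intro tendsto_intros) (simp add: add.commute)
  then have R_lim: "R \<longlonglongrightarrow> 1" by simp
  have "(\<lambda>N. abel_frac_power (R N) s T o\<^sub>L abel_frac_power (R N) (1 - s) T) \<longlonglongrightarrow>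
      (frac_power_I_minus \<alpha> s T o\<^sub>L frac_power_I_minus \<alpha> (1 - s) T)"
    using assms R R_lim
    by (intro bounded_bilinear.tendsto[OF bounded_bilinear_blinfun_compose] abel_frac_power_tendsto) auto
  moreover have "(\<lambda>N. abel_frac_power (R N) s T o\<^sub>L abel_frac_power (R N) (1 - s) T)
      = (\<lambda>N. id_blinfun - R N *\<^sub>R T)"
    using abel_frac_power_compose[OF assms(1,2) R assms(3,4)] by auto
  moreover have "(\<lambda>N. id_blinfun - R N *\<^sub>R T) \<longlonglongrightarrow> id_blinfun - 1 *\<^sub>R T"
    by (intro tendsto_intros R_lim)
  ultimately show ?thesis
    using LIMSEQ_unique by fastforce
qed

section \<open>Ranges and their closures\<close>

lemma subspace_range_blinfun: "subspace (range (blinfun_apply A))"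
  using blinfun.bounded_linear_right bounded_linear.linear subspace_UNIV
  by (intro linear_subspace_image) blast+

text \<open>Each T^j x - x lies in the range by telescoping, and the coefficients of the Cesaro sum
  add up to \<open>cesaro_k (\<alpha> + 1) n\<close>.\<close>

lemma cesaro_sum_minus_in_range:
  "cesaro_sum \<alpha> T n x - cesaro_k (\<alpha> + 1) n *\<^sub>R x \<in> range (blinfun_apply (id_blinfun - T))"
proof -
  let ?V = "range (blinfun_apply (id_blinfun - T))"
  have V: "subspace ?V"
    by (rule subspace_range_blinfun)
  have pow: "blinfun_pow T j x - x \<in> ?V" for j
  proof (induction j)
    case 0
    then show ?case using V by (simp add: subspace_0)
  next
    case (Suc j)
    have "blinfun_pow T j x - x - (id_blinfun - T) (blinfun_pow T j x) \<in> ?V"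
      by (intro subspace_diff[OF V] Suc rangeI)
    then show ?case
      by (simp add: blinfun_pow_Suc blinfun.diff_left)
  qed
  have "cesaro_k (\<alpha> + 1) n = (\<Sum>j\<le>n. cesaro_k \<alpha> (n - j))"
    using cesaro_k_convolution[of 1 \<alpha> n] by (simp add: cesaro_k_one add.commute)
  then have "cesaro_sum \<alpha> T n x - cesaro_k (\<alpha> + 1) n *\<^sub>R x
      = (\<Sum>j\<le>n. cesaro_k \<alpha> (n - j) *\<^sub>R (blinfun_pow T j x - x))"
    by (simp add: cesaro_sum_def atLeast0AtMost blinfun.sum_left blinfun.scaleR_left
        scaleR_sum_left scaleR_diff_right sum_subtractf)
  also have "\<dots> \<in> ?V"
    by (intro subspace_sum[OF V] subspace_scale[OF V] pow)
  finally show ?thesis .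
qed

lemma frac_power_in_closure_range:
  fixes T :: "'a::banach \<Rightarrow>\<^sub>L 'a"
  assumes "cesaro_bounded \<alpha> T" "\<alpha> \<ge> 0" "0 < s" "s < 1"
  shows "frac_power_I_minus \<alpha> s T x \<in> closure (range (blinfun_apply (id_blinfun - T)))"
proof -
  let ?V = "range (blinfun_apply (id_blinfun - T))"
  let ?w = "weyl_diff \<alpha> (cesaro_k (-s))"
  have V: "subspace ?V"
    by (rule subspace_range_blinfun)
  have sums: "(\<lambda>n. blinfun_apply (?w n *\<^sub>R cesaro_sum \<alpha> T n) x) sums frac_power_I_minus \<alpha> s T x"
    by (rule bounded_linear.sums[OF blinfun.bounded_linear_left frac_power_sums[OF assms]])
  \<comment> \<open>Subtracting this series of sum 0 keeps the limit but moves every term into the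
    range of I - T.\<close>
  have "(\<lambda>n. (?w n * cesaro_k (\<alpha> + 1) n) *\<^sub>R x) sums ((?w 0 * 0) *\<^sub>R x)"
    unfolding weyl_diff_times_cesaro_k[OF assms(2-4)]
    by (intro sums_scaleR_left sums_mult cesaro_k_sums_0 assms)
  from sums_diff[OF sums this] have "(\<lambda>n. ?w n *\<^sub>R (cesaro_sum \<alpha> T n x - cesaro_k (\<alpha> + 1) n *\<^sub>R x)) sums
      frac_power_I_minus \<alpha> s T x"
    by (simp add: blinfun.scaleR_left scaleR_diff_right)
  moreover have "(\<Sum>n<N. ?w n *\<^sub>R (cesaro_sum \<alpha> T n x - cesaro_k (\<alpha> + 1) n *\<^sub>R x)) \<in> ?V" for N
    by (intro subspace_sum[OF V] subspace_scale[OF V] cesaro_sum_minus_in_range)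
  ultimately show ?thesis
    unfolding sums_def closure_sequential
    by (intro exI[of _ "\<lambda>N. \<Sum>n<N. ?w n *\<^sub>R (cesaro_sum \<alpha> T n x - cesaro_k (\<alpha> + 1) n *\<^sub>R x)"] conjI allI)
qed

theorem proposition8:
  fixes T :: "'a::complex_banach \<Rightarrow>\<^sub>L 'a" and \<alpha> s :: real
  assumes "\<alpha> \<ge> 0"
    and "complex_linear T"
    and "cesaro_bounded \<alpha> T"
    and "0 < s" and "s < 1"
  shows "closure (range (blinfun_apply (frac_power_I_minus \<alpha> s T)))
       = closure (range (blinfun_apply (id_blinfun - T)))"
proof (rule antisym)
  show "closure (range (blinfun_apply (frac_power_I_minus \<alpha> s T)))
      \<subseteq> closure (range (blinfun_apply (id_blinfun - T)))"
    using frac_power_in_closure_range[OF assms(3,1,4,5)] by (intro closure_minimal) auto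
  \<comment> \<open>With exponent s as the outer factor, the ranges are included even before taking
    closures.\<close>
  have "blinfun_apply (id_blinfun - T) x
      = frac_power_I_minus \<alpha> s T (frac_power_I_minus \<alpha> (1 - s) T x)" for x
    using frac_power_compose[OF assms(3,1,4,5)] by (metis blinfun_apply_blinfun_compose)
  then show "closure (range (blinfun_apply (id_blinfun - T)))
      \<subseteq> closure (range (blinfun_apply (frac_power_I_minus \<alpha> s T)))"
    by (intro closure_mono) auto
qed

end
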